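(* For all finite multisets $\Gamma,\Delta$ of $\mathcal{L}_0$-formulas and every $\mathcal{L}_0$-formula $\varphi$: (1) $\Gamma\vdash_{\mathsf{MV}^s}[\varphi]$ iff $\Gamma\vdash_{\mathcal{MV}}[\varphi]$; (2) $\Gamma\vdash_{\mathsf{MV}}\Delta$ iff $\Gamma\vdash_{\mathcal{MV}}\Delta$.
   Context: $\mathcal{L}_0=\langle\wedge,\vee,\otimes,\to,1\rangle$ (commutative residuated lattice language, product written $\otimes$). $\mathcal{MV}$ is the variety of MV-algebras in this language, and for $\Gamma=[\varphi_1,\dots,\varphi_n]$, $\Delta=[\psi_1,\dots,\psi_m]$, $\Gamma\vdash_{\mathcal{MV}}\Delta$ iff $\mathcal{MV}\models\varphi_1\otimes\dots\otimes\varphi_n\leq\psi_1\otimes\dots\otimes\psi_m$ (empty product $=1$). A consecution is a pair $\Gamma\rhd\Delta$ of finite multisets of formulas; an axiomatic system is a substitution-closed set $\mathsf{AS}$ of consecutions (those with $\Gamma=\emptyset$ are axioms; the consecution $\emptyset\rhd[\varphi]$ is identified with $\varphi$). A derivation of $\Delta$ from $\Gamma$ in $\mathsf{AS}$ is a sequence $\langle\Gamma_1,\dots,\Gamma_n\rangle$ of finite multisets with $\Gamma_1=\Gamma$, for each $1<j\leq n$ a consecution $\Psi\rhd\Psi'\in\mathsf{AS}$ with $\Psi\leqslant\Gamma_{j-1}$ (sub-multiset) and $\Gamma_j=(\Gamma_{j-1}\setminus\Psi)\uplus\Psi'$ (truncated multiset difference, multiset sum), and $\Delta\leqslant\Gamma_n$;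 $\Gamma\vdash_{\mathsf{AS}}\Delta$ iff a derivation exists. $\mathsf{MV}^s$ is the axiomatic system whose axioms are all substitution instances of the axioms of infinite-valued Łukasiewicz logic (formulated in $\mathcal{L}_0$) and whose only rule is (MP): all instances of $[\varphi,\varphi\to\psi]\rhd[\psi]$. $\mathsf{MV}$ extends $\mathsf{MV}^s$ by the rule ($\otimes$-Elim): all instances of $[\varphi\otimes\psi]\rhd[\varphi,\psi]$. *)

theory Defs
  imports "HOL-Library.Multiset" "HOL-Algebra.Group"
begin

subsection \<open>Formulas and substitutions\<close>

datatype fm =
    Var nat
  | One  (\<open>\<^bold>1\<close>)
  | Meet fm fm  (infixl \<open>\<^bold>\<and>\<close> 68)
  | Join fm fm  (infixl \<open>\<^bold>\<or>\<close> 67)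
  | Tensor fm fm  (infixl \<open>\<^bold>\<otimes>\<close> 70)
  | Imp fm fm  (infixr \<open>\<^bold>\<rightarrow>\<close> 65)

primrec subst :: "(nat \<Rightarrow> fm) \<Rightarrow> fm \<Rightarrow> fm" where
  "subst \<sigma> (Var n) = \<sigma> n"
| "subst \<sigma> \<^bold>1 = \<^bold>1"
| "subst \<sigma> (\<phi> \<^bold>\<and> \<psi>) = subst \<sigma> \<phi> \<^bold>\<and> subst \<sigma> \<psi>"
| "subst \<sigma> (\<phi> \<^bold>\<or> \<psi>) = subst \<sigma> \<phi> \<^bold>\<or> subst \<sigma> \<psi>"
| "subst \<sigma> (\<phi> \<^bold>\<otimes> \<psi>) = subst \<sigma> \<phi> \<^bold>\<otimes> subst \<sigma> \<psi>"
| "subst \<sigma> (\<phi> \<^bold>\<rightarrow> \<psi>) = subst \<sigma> \<phi> \<^bold>\<rightarrow> subst \<sigma> \<psi>"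


subsection \<open>Axiomatic systems and derivations\<close>

type_synonym consecution = "fm multiset \<times> fm multiset"

definition axiomatic_system :: "consecution set \<Rightarrow> bool" where
  "axiomatic_system AS \<longleftrightarrow>
     (\<forall>\<Gamma> \<Delta> \<sigma>. (\<Gamma>, \<Delta>) \<in> AS \<longrightarrow> (image_mset (subst \<sigma>) \<Gamma>, image_mset (subst \<sigma>) \<Delta>) \<in> AS)"

definition is_derivation ::
  "consecution set \<Rightarrow> fm multiset \<Rightarrow> fm multiset \<Rightarrow> fm multiset list \<Rightarrow> bool" where
  "is_derivation AS \<Gamma> \<Delta> ds \<longleftrightarrow>
     ds \<noteq> [] \<and> hd ds = \<Gamma> \<and>
     (\<forall>j. 0 < j \<and> j < length ds \<longrightarrow>
        (\<exists>\<Psi> \<Psi>'. (\<Psi>, \<Psi>') \<in> AS \<and> \<Psi> \<subseteq># ds ! (j - 1) \<and>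
               ds ! j = (ds ! (j - 1) - \<Psi>) + \<Psi>')) \<and>
     \<Delta> \<subseteq># last ds"

definition derives :: "consecution set \<Rightarrow> fm multiset \<Rightarrow> fm multiset \<Rightarrow> bool" where
  "derives AS \<Gamma> \<Delta> \<longleftrightarrow> (\<exists>ds. is_derivation AS \<Gamma> \<Delta> ds)"

text \<open>
  Axioms of infinite-valued Lukasiewicz logic over \<open>\<and>, \<or>, \<otimes>, \<rightarrow>, 1\<close>. The language has no
  falsum, so the presentation is the falsum-free one of Esteva, Godo, Hajek and Montagna
  (Hoops and fuzzy logic, 2003): Hajek's axioms of BL without \<open>0 \<rightarrow> \<phi>\<close>, together with
  \<open>((\<phi> \<rightarrow> \<psi>) \<rightarrow> \<psi>) \<rightarrow> ((\<psi> \<rightarrow> \<phi>) \<rightarrow> \<phi>)\<close>, which over BL is equivalent to the double negation law.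
  The lattice connectives and \<open>1\<close>, usually introduced as abbreviations, are primitive here, so
  their definitions \<open>\<phi> \<otimes> (\<phi> \<rightarrow> \<psi>)\<close> and \<open>(\<phi> \<rightarrow> \<psi>) \<rightarrow> \<psi>\<close> appear as pairs of implications.
\<close>

inductive_set luk_axioms :: "fm set" where
  suffixing: "(\<phi> \<^bold>\<rightarrow> \<psi>) \<^bold>\<rightarrow> (\<psi> \<^bold>\<rightarrow> \<chi>) \<^bold>\<rightarrow> (\<phi> \<^bold>\<rightarrow> \<chi>) \<in> luk_axioms"
| weakening: "\<phi> \<^bold>\<otimes> \<psi> \<^bold>\<rightarrow> \<phi> \<in> luk_axioms"
| commutativity: "\<phi> \<^bold>\<otimes> \<psi> \<^bold>\<rightarrow> \<psi> \<^bold>\<otimes> \<phi> \<in> luk_axioms"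
| divisibility: "\<phi> \<^bold>\<otimes> (\<phi> \<^bold>\<rightarrow> \<psi>) \<^bold>\<rightarrow> \<psi> \<^bold>\<otimes> (\<psi> \<^bold>\<rightarrow> \<phi>) \<in> luk_axioms"
| importation: "(\<phi> \<^bold>\<rightarrow> \<psi> \<^bold>\<rightarrow> \<chi>) \<^bold>\<rightarrow> (\<phi> \<^bold>\<otimes> \<psi> \<^bold>\<rightarrow> \<chi>) \<in> luk_axioms"
| exportation: "(\<phi> \<^bold>\<otimes> \<psi> \<^bold>\<rightarrow> \<chi>) \<^bold>\<rightarrow> (\<phi> \<^bold>\<rightarrow> \<psi> \<^bold>\<rightarrow> \<chi>) \<in> luk_axioms"
| prelinearity: "((\<phi> \<^bold>\<rightarrow> \<psi>) \<^bold>\<rightarrow> \<chi>) \<^bold>\<rightarrow> ((\<psi> \<^bold>\<rightarrow> \<phi>) \<^bold>\<rightarrow> \<chi>) \<^bold>\<rightarrow> \<chi> \<in> luk_axioms"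
| wajsberg: "((\<phi> \<^bold>\<rightarrow> \<psi>) \<^bold>\<rightarrow> \<psi>) \<^bold>\<rightarrow> ((\<psi> \<^bold>\<rightarrow> \<phi>) \<^bold>\<rightarrow> \<phi>) \<in> luk_axioms"
| meet1: "\<phi> \<^bold>\<and> \<psi> \<^bold>\<rightarrow> \<phi> \<^bold>\<otimes> (\<phi> \<^bold>\<rightarrow> \<psi>) \<in> luk_axioms"
| meet2: "\<phi> \<^bold>\<otimes> (\<phi> \<^bold>\<rightarrow> \<psi>) \<^bold>\<rightarrow> \<phi> \<^bold>\<and> \<psi> \<in> luk_axioms"
| join1: "\<phi> \<^bold>\<or> \<psi> \<^bold>\<rightarrow> ((\<phi> \<^bold>\<rightarrow> \<psi>) \<^bold>\<rightarrow> \<psi>) \<in> luk_axioms"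
| join2: "((\<phi> \<^bold>\<rightarrow> \<psi>) \<^bold>\<rightarrow> \<psi>) \<^bold>\<rightarrow> \<phi> \<^bold>\<or> \<psi> \<in> luk_axioms"
| unit: "\<^bold>1 \<in> luk_axioms"

definition MP :: "consecution set" where
  "MP = {({#\<phi>, \<phi> \<^bold>\<rightarrow> \<psi>#}, {#\<psi>#}) | \<phi> \<psi>. True}"

definition Tensor_Elim :: "consecution set" where
  "Tensor_Elim = {({#\<phi> \<^bold>\<otimes> \<psi>#}, {#\<phi>, \<psi>#}) | \<phi> \<psi>. True}"

definition MVs :: "consecution set" where
  "MVs = {({#}, {#\<alpha>#}) | \<alpha>. \<alpha> \<in> luk_axioms} \<union> MP"

definition MV :: "consecution set" where
  "MV = MVs \<union> Tensor_Elim"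

lemma luk_axioms_subst: "\<alpha> \<in> luk_axioms \<Longrightarrow> subst \<sigma> \<alpha> \<in> luk_axioms"
  by (induction rule: luk_axioms.induct) (auto intro: luk_axioms.intros)

lemma axiomatic_system_MVs: "axiomatic_system MVs"
  by (auto simp: axiomatic_system_def MVs_def MP_def luk_axioms_subst)

lemma axiomatic_system_MV: "axiomatic_system MV"
  using axiomatic_system_MVs
  by (auto simp: axiomatic_system_def MV_def Tensor_Elim_def)


subsection \<open>MV-algebras\<close>

record 'a l0_algebra = "'a monoid" +
  wedge :: "'a \<Rightarrow> 'a \<Rightarrow> 'a"  (infixl \<open>\<curlywedge>\<index>\<close> 70)
  vee :: "'a \<Rightarrow> 'a \<Rightarrow> 'a"  (infixl \<open>\<curlyvee>\<index>\<close> 65)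
  res :: "'a \<Rightarrow> 'a \<Rightarrow> 'a"  (infixr \<open>\<leadsto>\<index>\<close> 65)

definition l0_le :: "('a, 'b) l0_algebra_scheme \<Rightarrow> 'a \<Rightarrow> 'a \<Rightarrow> bool"  (infix \<open>\<preceq>\<index>\<close> 50) where
  "x \<preceq>\<^bsub>A\<^esub> y \<longleftrightarrow> x \<curlywedge>\<^bsub>A\<^esub> y = x"

locale comm_residuated_lattice = comm_monoid A for A (structure) +
  assumes wedge_closed: "\<lbrakk>x \<in> carrier A; y \<in> carrier A\<rbrakk> \<Longrightarrow> x \<curlywedge> y \<in> carrier A"
    and vee_closed: "\<lbrakk>x \<in> carrier A; y \<in> carrier A\<rbrakk> \<Longrightarrow> x \<curlyvee> y \<in> carrier A"
    and res_closed: "\<lbrakk>x \<in> carrier A; y \<in> carrier A\<rbrakk> \<Longrightarrow> x \<leadsto> y \<in> carrier A"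
    and wedge_commute: "\<lbrakk>x \<in> carrier A; y \<in> carrier A\<rbrakk> \<Longrightarrow> x \<curlywedge> y = y \<curlywedge> x"
    and vee_commute: "\<lbrakk>x \<in> carrier A; y \<in> carrier A\<rbrakk> \<Longrightarrow> x \<curlyvee> y = y \<curlyvee> x"
    and wedge_assoc: "\<lbrakk>x \<in> carrier A; y \<in> carrier A; z \<in> carrier A\<rbrakk>
      \<Longrightarrow> (x \<curlywedge> y) \<curlywedge> z = x \<curlywedge> (y \<curlywedge> z)"
    and vee_assoc: "\<lbrakk>x \<in> carrier A; y \<in> carrier A; z \<in> carrier A\<rbrakk>
      \<Longrightarrow> (x \<curlyvee> y) \<curlyvee> z = x \<curlyvee> (y \<curlyvee> z)"
    and wedge_vee_absorb: "\<lbrakk>x \<in> carrier A; y \<in> carrier A\<rbrakk> \<Longrightarrow> x \<curlywedge> (x \<curlyvee> y) = x"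
    and vee_wedge_absorb: "\<lbrakk>x \<in> carrier A; y \<in> carrier A\<rbrakk> \<Longrightarrow> x \<curlyvee> (x \<curlywedge> y) = x"
    and residuation: "\<lbrakk>x \<in> carrier A; y \<in> carrier A; z \<in> carrier A\<rbrakk>
      \<Longrightarrow> x \<otimes> y \<preceq> z \<longleftrightarrow> x \<preceq> y \<leadsto> z"

text \<open>
  The least element \<open>0\<close> of an MV-algebra is not named by an operation of the language (negation
  is \<open>x \<leadsto> 0\<close>), so its existence is required instead.
\<close>

locale mv_algebra = comm_residuated_lattice +
  assumes integral: "x \<in> carrier A \<Longrightarrow> x \<preceq> \<one>"
    and bounded: "\<exists>z \<in> carrier A. \<forall>x \<in> carrier A. z \<preceq> x"
    and vee_eq: "\<lbrakk>x \<in> carrier A; y \<in> carrier A\<rbrakk> \<Longrightarrow> x \<curlyvee> y = (x \<leadsto> y) \<leadsto> y"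

primrec eval :: "('a, 'b) l0_algebra_scheme \<Rightarrow> (nat \<Rightarrow> 'a) \<Rightarrow> fm \<Rightarrow> 'a" where
  "eval A e (Var n) = e n"
| "eval A e \<^bold>1 = \<one>\<^bsub>A\<^esub>"
| "eval A e (\<phi> \<^bold>\<and> \<psi>) = eval A e \<phi> \<curlywedge>\<^bsub>A\<^esub> eval A e \<psi>"
| "eval A e (\<phi> \<^bold>\<or> \<psi>) = eval A e \<phi> \<curlyvee>\<^bsub>A\<^esub> eval A e \<psi>"
| "eval A e (\<phi> \<^bold>\<otimes> \<psi>) = eval A e \<phi> \<otimes>\<^bsub>A\<^esub> eval A e \<psi>"
| "eval A e (\<phi> \<^bold>\<rightarrow> \<psi>) = eval A e \<phi> \<leadsto>\<^bsub>A\<^esub> eval A e \<psi>"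

text \<open>
  HOL cannot quantify over all types inside a formula, so validity in all MV-algebras is relative
  to the type \<open>'a\<close> from which the carriers are drawn.
\<close>

definition MV_valid_le :: "'a itself \<Rightarrow> fm \<Rightarrow> fm \<Rightarrow> bool" where
  "MV_valid_le _ \<phi> \<psi> \<longleftrightarrow>
     (\<forall>A :: 'a l0_algebra. mv_algebra A \<longrightarrow>
        (\<forall>e. range e \<subseteq> carrier A \<longrightarrow> eval A e \<phi> \<preceq>\<^bsub>A\<^esub> eval A e \<psi>))"

definition tensor_list :: "fm list \<Rightarrow> fm" where
  "tensor_list \<phi>s = foldr Tensor \<phi>s \<^bold>1"

definition MV_entails :: "'a itself \<Rightarrow> fm multiset \<Rightarrow> fm multiset \<Rightarrow> bool" where
  "MV_entails T \<Gamma> \<Delta> \<longleftrightarrow>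
     (\<forall>\<phi>s \<psi>s. mset \<phi>s = \<Gamma> \<and> mset \<psi>s = \<Delta> \<longrightarrow>
        MV_valid_le T (tensor_list \<phi>s) (tensor_list \<psi>s))"

end

theory Submission
  imports Defs "HOL-Library.Countable"
begin

text \<open>
  Formulas modulo provable equivalence form a Wajsberg hoop, which is not bounded because the
  language lacks falsum. Every interval \<open>[a, 1]\<close> of it is an MV-algebra, however, with product
  \<open>(x \<otimes> y) \<or> a\<close> and the other operations unchanged, and for \<open>a\<close> small enough the canonical
  valuation of a given formula is not affected by the truncation. So provability coincides with
  validity in MV-algebras. Since the rules consume their premises, a derivation can only increase
  the product of the current multiset; conversely, a provable \<open>\<phi>\<^sub>1 \<rightarrow> \<dots> \<rightarrow> \<phi>\<^sub>n \<rightarrow> \<psi>\<close> is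
  detached by using each premise once, and tensor elimination splits \<open>\<psi>\<close>.
\<close>

section \<open>Provability in Lukasiewicz logic\<close>

text \<open>Ordinary Hilbert provability, where theorems may be reused at will.
  \<open>MVs_add_provable\<close> later links it to derivations, which consume their
  premises.\<close>

inductive luk_provable :: "fm \<Rightarrow> bool" where
  ax: "\<alpha> \<in> luk_axioms \<Longrightarrow> luk_provable \<alpha>"
| mp: "luk_provable \<phi> \<Longrightarrow> luk_provable (\<phi> \<^bold>\<rightarrow> \<psi>) \<Longrightarrow> luk_provable \<psi>"

definition luk_le :: "fm \<Rightarrow> fm \<Rightarrow> bool"  (infix \<open>\<lesssim>\<close> 50) where
  "\<phi> \<lesssim> \<psi> \<longleftrightarrow> luk_provable (\<phi> \<^bold>\<rightarrow> \<psi>)"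

definition luk_equiv :: "fm \<Rightarrow> fm \<Rightarrow> bool"  (infix \<open>\<simeq>\<close> 50) where
  "\<phi> \<simeq> \<psi> \<longleftrightarrow> \<phi> \<lesssim> \<psi> \<and> \<psi> \<lesssim> \<phi>"

lemma luk_le_trans [trans]: "\<phi> \<lesssim> \<psi> \<Longrightarrow> \<psi> \<lesssim> \<chi> \<Longrightarrow> \<phi> \<lesssim> \<chi>"
  unfolding luk_le_def by (meson ax mp suffixing)

lemma luk_provable_if_le: "luk_provable \<phi> \<Longrightarrow> \<phi> \<lesssim> \<psi> \<Longrightarrow> luk_provable \<psi>"
  unfolding luk_le_def by (rule mp)

lemma luk_le_axiom: "\<phi> \<^bold>\<rightarrow> \<psi> \<in> luk_axioms \<Longrightarrow> \<phi> \<lesssim> \<psi>"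
  unfolding luk_le_def by (rule ax)

lemma luk_residuation: "\<phi> \<^bold>\<otimes> \<psi> \<lesssim> \<chi> \<longleftrightarrow> \<phi> \<lesssim> \<psi> \<^bold>\<rightarrow> \<chi>"
  unfolding luk_le_def by (meson ax mp importation exportation)

lemma luk_tensor_le1: "\<phi> \<^bold>\<otimes> \<psi> \<lesssim> \<phi>"
  by (rule luk_le_axiom, rule weakening)

lemma luk_tensor_commute_le: "\<phi> \<^bold>\<otimes> \<psi> \<lesssim> \<psi> \<^bold>\<otimes> \<phi>"
  by (rule luk_le_axiom, rule commutativity)

lemma luk_tensor_le2: "\<phi> \<^bold>\<otimes> \<psi> \<lesssim> \<psi>"
  using luk_tensor_commute_le luk_tensor_le1 luk_le_trans by blast

lemma luk_le_imp: "\<psi> \<lesssim> \<phi> \<^bold>\<rightarrow> \<psi>"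
  using luk_tensor_le1 luk_residuation by blast

lemma luk_exchange: "\<phi> \<lesssim> \<psi> \<^bold>\<rightarrow> \<chi> \<longleftrightarrow> \<psi> \<lesssim> \<phi> \<^bold>\<rightarrow> \<chi>"
  using luk_residuation luk_tensor_commute_le luk_le_trans by blast

lemma luk_le_provable: "luk_provable \<psi> \<Longrightarrow> \<phi> \<lesssim> \<psi>"
  using luk_le_imp luk_provable_if_le luk_le_def by blast

lemma luk_le_one: "\<phi> \<lesssim> \<^bold>1"
  by (rule luk_le_provable, rule ax, rule unit)

text \<open>Weakening gives \<open>\<phi> \<lesssim> 1 \<rightarrow> \<phi>\<close>; exchanging the
  antecedents gives \<open>1 \<lesssim> \<phi> \<rightarrow> \<phi>\<close>, and the axiom
  \<open>1\<close> is detached.\<close>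

lemma luk_le_refl [simp, intro!]: "\<phi> \<lesssim> \<phi>"
  using luk_le_imp luk_exchange luk_provable_if_le ax unit luk_le_def by meson

lemma luk_le_iff_provable: "\<^bold>1 \<lesssim> \<phi> \<longleftrightarrow> luk_provable \<phi>"
  using luk_le_provable luk_provable_if_le ax unit by blast

lemma luk_imp_elim: "\<phi> \<^bold>\<otimes> (\<phi> \<^bold>\<rightarrow> \<psi>) \<lesssim> \<psi>" "(\<phi> \<^bold>\<rightarrow> \<psi>) \<^bold>\<otimes> \<phi> \<lesssim> \<psi>"
  using luk_residuation luk_exchange by blast+

lemma luk_tensor_mono: "\<phi> \<lesssim> \<phi>' \<Longrightarrow> \<psi> \<lesssim> \<psi>' \<Longrightarrow> \<phi> \<^bold>\<otimes> \<psi> \<lesssim> \<phi>' \<^bold>\<otimes> \<psi>'"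
proof -
  have right: "\<chi> \<^bold>\<otimes> \<alpha> \<lesssim> \<chi>' \<^bold>\<otimes> \<alpha>" if "\<chi> \<lesssim> \<chi>'" for \<chi> \<chi>' \<alpha>
    using that luk_residuation luk_le_trans luk_le_refl by blast
  assume "\<phi> \<lesssim> \<phi>'" "\<psi> \<lesssim> \<psi>'"
  then show ?thesis
    using right luk_tensor_commute_le luk_le_trans by meson
qed

lemma luk_imp_mono: "\<phi>' \<lesssim> \<phi> \<Longrightarrow> \<psi> \<lesssim> \<psi>' \<Longrightarrow> \<phi> \<^bold>\<rightarrow> \<psi> \<lesssim> \<phi>' \<^bold>\<rightarrow> \<psi>'"
  by (meson luk_residuation luk_imp_elim luk_le_trans luk_tensor_mono luk_le_refl)

lemma luk_le_tensor_one: "\<phi> \<lesssim> \<phi> \<^bold>\<otimes> \<^bold>1" "\<phi> \<lesssim> \<^bold>1 \<^bold>\<otimes> \<phi>"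
proof -
  have "\<^bold>1 \<lesssim> \<phi> \<^bold>\<rightarrow> \<^bold>1 \<^bold>\<otimes> \<phi>"
    using luk_residuation by blast
  then show "\<phi> \<lesssim> \<^bold>1 \<^bold>\<otimes> \<phi>"
    using luk_le_iff_provable luk_le_def by blast
  then show "\<phi> \<lesssim> \<phi> \<^bold>\<otimes> \<^bold>1"
    using luk_tensor_commute_le luk_le_trans by blast
qed

lemma luk_curry: "(\<phi> \<^bold>\<otimes> \<psi>) \<^bold>\<rightarrow> \<chi> \<lesssim> \<phi> \<^bold>\<rightarrow> \<psi> \<^bold>\<rightarrow> \<chi>" "\<phi> \<^bold>\<rightarrow> \<psi> \<^bold>\<rightarrow> \<chi> \<lesssim> (\<phi> \<^bold>\<otimes> \<psi>) \<^bold>\<rightarrow> \<chi>"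
  by (rule luk_le_axiom, rule exportation) (rule luk_le_axiom, rule importation)

text \<open>Currying shows that both bracketings have the same upper bounds, so each lies below the
  other.\<close>

lemma luk_tensor_assoc:
  "(\<phi> \<^bold>\<otimes> \<psi>) \<^bold>\<otimes> \<chi> \<lesssim> \<phi> \<^bold>\<otimes> (\<psi> \<^bold>\<otimes> \<chi>)" "\<phi> \<^bold>\<otimes> (\<psi> \<^bold>\<otimes> \<chi>) \<lesssim> (\<phi> \<^bold>\<otimes> \<psi>) \<^bold>\<otimes> \<chi>"
proof -
  have "(\<phi> \<^bold>\<otimes> \<psi>) \<^bold>\<otimes> \<chi> \<lesssim> \<alpha> \<longleftrightarrow> \<phi> \<^bold>\<otimes> (\<psi> \<^bold>\<otimes> \<chi>) \<lesssim> \<alpha>" for \<alpha>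
    using luk_residuation luk_curry luk_le_trans by meson
  then show "(\<phi> \<^bold>\<otimes> \<psi>) \<^bold>\<otimes> \<chi> \<lesssim> \<phi> \<^bold>\<otimes> (\<psi> \<^bold>\<otimes> \<chi>)" "\<phi> \<^bold>\<otimes> (\<psi> \<^bold>\<otimes> \<chi>) \<lesssim> (\<phi> \<^bold>\<otimes> \<psi>) \<^bold>\<otimes> \<chi>"
    by blast+
qed

lemma luk_meet_le1: "\<phi> \<^bold>\<and> \<psi> \<lesssim> \<phi>"
  using luk_le_axiom[OF meet1] luk_tensor_le1 luk_le_trans by blast

lemma luk_meet_le2: "\<phi> \<^bold>\<and> \<psi> \<lesssim> \<psi>"
  using luk_le_axiom[OF meet1] luk_imp_elim luk_le_trans by blast

text \<open>As \<open>\<chi> \<rightarrow> \<phi>\<close> is provable, \<chi> lies below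
  \<open>\<chi> \<otimes> (\<chi> \<rightarrow> \<phi>)\<close>. Divisibility turns this into
  \<open>\<phi> \<otimes> (\<phi> \<rightarrow> \<chi>)\<close>, where \<chi> can be raised to
  \<psi>.\<close>

lemma luk_le_meet: "\<chi> \<lesssim> \<phi> \<Longrightarrow> \<chi> \<lesssim> \<psi> \<Longrightarrow> \<chi> \<lesssim> \<phi> \<^bold>\<and> \<psi>"
proof -
  assume le: "\<chi> \<lesssim> \<phi>" "\<chi> \<lesssim> \<psi>"
  have "\<chi> \<lesssim> \<chi> \<^bold>\<otimes> \<^bold>1"
    by (rule luk_le_tensor_one)
  also have "\<chi> \<^bold>\<otimes> \<^bold>1 \<lesssim> \<chi> \<^bold>\<otimes> (\<chi> \<^bold>\<rightarrow> \<phi>)"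
    using le(1) by (intro luk_tensor_mono) (auto simp: luk_le_iff_provable luk_le_def[symmetric])
  also have "\<chi> \<^bold>\<otimes> (\<chi> \<^bold>\<rightarrow> \<phi>) \<lesssim> \<phi> \<^bold>\<otimes> (\<phi> \<^bold>\<rightarrow> \<chi>)"
    by (rule luk_le_axiom, rule divisibility)
  also have "\<phi> \<^bold>\<otimes> (\<phi> \<^bold>\<rightarrow> \<chi>) \<lesssim> \<phi> \<^bold>\<otimes> (\<phi> \<^bold>\<rightarrow> \<psi>)"
    using le(2) by (intro luk_tensor_mono luk_imp_mono) auto
  also have "\<phi> \<^bold>\<otimes> (\<phi> \<^bold>\<rightarrow> \<psi>) \<lesssim> \<phi> \<^bold>\<and> \<psi>"
    by (rule luk_le_axiom, rule meet2)
  finally show ?thesis .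
qed

lemma luk_join_ge1: "\<phi> \<lesssim> \<phi> \<^bold>\<or> \<psi>"
  using luk_le_axiom[OF join2] luk_imp_elim(1) luk_residuation luk_le_trans by blast

lemma luk_join_ge2: "\<psi> \<lesssim> \<phi> \<^bold>\<or> \<psi>"
  using luk_le_axiom[OF join2] luk_le_imp luk_le_trans by blast

text \<open>The formula defining the join is monotone in \<phi>, so \<phi> can be raised to \<chi>.
  The Wajsberg axiom then exchanges the roles of \<chi> and \<psi>, and the provable
  \<open>\<psi> \<rightarrow> \<chi>\<close> is detached.\<close>

lemma luk_join_le: "\<phi> \<lesssim> \<chi> \<Longrightarrow> \<psi> \<lesssim> \<chi> \<Longrightarrow> \<phi> \<^bold>\<or> \<psi> \<lesssim> \<chi>"
proof -
  assume le: "\<phi> \<lesssim> \<chi>" "\<psi> \<lesssim> \<chi>"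
  have "\<phi> \<^bold>\<or> \<psi> \<lesssim> (\<phi> \<^bold>\<rightarrow> \<psi>) \<^bold>\<rightarrow> \<psi>"
    by (rule luk_le_axiom, rule join1)
  also have "\<dots> \<lesssim> (\<chi> \<^bold>\<rightarrow> \<psi>) \<^bold>\<rightarrow> \<psi>"
    using le(1) by (intro luk_imp_mono) auto
  also have "\<dots> \<lesssim> (\<psi> \<^bold>\<rightarrow> \<chi>) \<^bold>\<rightarrow> \<chi>"
    by (rule luk_le_axiom, rule wajsberg)
  also have "\<dots> \<lesssim> \<chi>"
    using le(2) by (meson luk_exchange luk_le_def luk_provable_if_le luk_le_refl)
  finally show ?thesis .
qed

section \<open>Provable equivalence as a congruence\<close>

lemma luk_equiv_refl [simp, intro!]: "\<phi> \<simeq> \<phi>"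
  by (simp add: luk_equiv_def)

lemma luk_equiv_sym: "\<phi> \<simeq> \<psi> \<Longrightarrow> \<psi> \<simeq> \<phi>"
  by (simp add: luk_equiv_def)

lemma luk_equiv_trans [trans]: "\<phi> \<simeq> \<psi> \<Longrightarrow> \<psi> \<simeq> \<chi> \<Longrightarrow> \<phi> \<simeq> \<chi>"
  using luk_equiv_def luk_le_trans by blast

lemma luk_join_mono: "\<phi> \<lesssim> \<phi>' \<Longrightarrow> \<psi> \<lesssim> \<psi>' \<Longrightarrow> \<phi> \<^bold>\<or> \<psi> \<lesssim> \<phi>' \<^bold>\<or> \<psi>'"
  by (meson luk_join_le luk_join_ge1 luk_join_ge2 luk_le_trans)

lemma luk_meet_mono: "\<phi> \<lesssim> \<phi>' \<Longrightarrow> \<psi> \<lesssim> \<psi>' \<Longrightarrow> \<phi> \<^bold>\<and> \<psi> \<lesssim> \<phi>' \<^bold>\<and> \<psi>'"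
  by (meson luk_le_meet luk_meet_le1 luk_meet_le2 luk_le_trans)

lemma luk_tensor_cong: "\<phi> \<simeq> \<phi>' \<Longrightarrow> \<psi> \<simeq> \<psi>' \<Longrightarrow> \<phi> \<^bold>\<otimes> \<psi> \<simeq> \<phi>' \<^bold>\<otimes> \<psi>'"
  and luk_imp_cong: "\<phi> \<simeq> \<phi>' \<Longrightarrow> \<psi> \<simeq> \<psi>' \<Longrightarrow> \<phi> \<^bold>\<rightarrow> \<psi> \<simeq> \<phi>' \<^bold>\<rightarrow> \<psi>'"
  and luk_meet_cong: "\<phi> \<simeq> \<phi>' \<Longrightarrow> \<psi> \<simeq> \<psi>' \<Longrightarrow> \<phi> \<^bold>\<and> \<psi> \<simeq> \<phi>' \<^bold>\<and> \<psi>'"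
  and luk_join_cong: "\<phi> \<simeq> \<phi>' \<Longrightarrow> \<psi> \<simeq> \<psi>' \<Longrightarrow> \<phi> \<^bold>\<or> \<psi> \<simeq> \<phi>' \<^bold>\<or> \<psi>'"
  by (auto simp: luk_equiv_def intro: luk_tensor_mono luk_imp_mono luk_meet_mono luk_join_mono)

lemma luk_join_le_iff: "\<phi> \<^bold>\<or> \<psi> \<lesssim> \<chi> \<longleftrightarrow> \<phi> \<lesssim> \<chi> \<and> \<psi> \<lesssim> \<chi>"
  by (meson luk_join_le luk_join_ge1 luk_join_ge2 luk_le_trans)

lemma luk_le_meet_iff: "\<chi> \<lesssim> \<phi> \<^bold>\<and> \<psi> \<longleftrightarrow> \<chi> \<lesssim> \<phi> \<and> \<chi> \<lesssim> \<psi>"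
  by (meson luk_le_meet luk_meet_le1 luk_meet_le2 luk_le_trans)

text \<open>Comparing upper bounds reduces laws about joins to propositional equivalences; lower
  bounds do the same for meets.\<close>

lemma luk_equiv_iff_upper: "\<phi> \<simeq> \<psi> \<longleftrightarrow> (\<forall>\<chi>. \<phi> \<lesssim> \<chi> \<longleftrightarrow> \<psi> \<lesssim> \<chi>)"
  using luk_equiv_def luk_le_trans by blast

lemma luk_equiv_iff_lower: "\<phi> \<simeq> \<psi> \<longleftrightarrow> (\<forall>\<chi>. \<chi> \<lesssim> \<phi> \<longleftrightarrow> \<chi> \<lesssim> \<psi>)"
  using luk_equiv_def luk_le_trans by blast

lemma luk_tensor_assoc_equiv: "(\<phi> \<^bold>\<otimes> \<psi>) \<^bold>\<otimes> \<chi> \<simeq> \<phi> \<^bold>\<otimes> (\<psi> \<^bold>\<otimes> \<chi>)"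
  using luk_tensor_assoc by (simp add: luk_equiv_def)

lemma luk_tensor_commute: "\<phi> \<^bold>\<otimes> \<psi> \<simeq> \<psi> \<^bold>\<otimes> \<phi>"
  using luk_tensor_commute_le by (simp add: luk_equiv_def)

lemma luk_tensor_one: "\<phi> \<^bold>\<otimes> \<^bold>1 \<simeq> \<phi>" "\<^bold>1 \<^bold>\<otimes> \<phi> \<simeq> \<phi>"
  using luk_le_tensor_one luk_tensor_le1 luk_tensor_le2 by (auto simp: luk_equiv_def)

text \<open>Residuation moves \<chi> to the right-hand side, so the product distributes over
  joins.\<close>

lemma luk_join_tensor_le_iff:
  "(\<phi> \<^bold>\<or> \<psi>) \<^bold>\<otimes> \<chi> \<lesssim> \<alpha> \<longleftrightarrow> \<phi> \<^bold>\<otimes> \<chi> \<lesssim> \<alpha> \<and> \<psi> \<^bold>\<otimes> \<chi> \<lesssim> \<alpha>"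
  by (simp add: luk_residuation luk_join_le_iff)

lemma luk_tensor_join_le_iff:
  "\<chi> \<^bold>\<otimes> (\<phi> \<^bold>\<or> \<psi>) \<lesssim> \<alpha> \<longleftrightarrow> \<chi> \<^bold>\<otimes> \<phi> \<lesssim> \<alpha> \<and> \<chi> \<^bold>\<otimes> \<psi> \<lesssim> \<alpha>"
  by (meson luk_join_tensor_le_iff luk_equiv_iff_upper luk_tensor_commute)


section \<open>Soundness in MV-algebras\<close>

context comm_residuated_lattice
begin

declare wedge_closed [simp, intro] vee_closed [simp, intro] res_closed [simp, intro]

lemma le_refl [simp]: "x \<in> carrier A \<Longrightarrow> x \<preceq> x"
  by (metis l0_le_def vee_wedge_absorb wedge_vee_absorb wedge_closed)

lemma le_antisym: "x \<preceq> y \<Longrightarrow> y \<preceq> x \<Longrightarrow> x \<in> carrier A \<Longrightarrow> y \<in> carrier A \<Longrightarrow> x = y"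
  by (metis l0_le_def wedge_commute)

lemma le_trans:
  "x \<preceq> y \<Longrightarrow> y \<preceq> z \<Longrightarrow> x \<in> carrier A \<Longrightarrow> y \<in> carrier A \<Longrightarrow> z \<in> carrier A \<Longrightarrow> x \<preceq> z"
  by (metis l0_le_def wedge_assoc)

lemma le_iff_vee: "x \<in> carrier A \<Longrightarrow> y \<in> carrier A \<Longrightarrow> x \<preceq> y \<longleftrightarrow> x \<curlyvee> y = y"
  by (metis l0_le_def wedge_vee_absorb vee_wedge_absorb wedge_commute vee_commute)

lemma vee_least:
  "x \<preceq> z \<Longrightarrow> y \<preceq> z \<Longrightarrow> x \<in> carrier A \<Longrightarrow> y \<in> carrier A \<Longrightarrow> z \<in> carrier A \<Longrightarrow> x \<curlyvee> y \<preceq> z"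
  by (metis le_iff_vee vee_assoc vee_closed)

lemma wedge_le: "x \<in> carrier A \<Longrightarrow> y \<in> carrier A \<Longrightarrow> x \<curlywedge> y \<preceq> x"
  "x \<in> carrier A \<Longrightarrow> y \<in> carrier A \<Longrightarrow> x \<curlywedge> y \<preceq> y"
  by (metis le_iff_vee vee_wedge_absorb vee_commute wedge_commute wedge_closed)+

lemma wedge_greatest:
  "z \<preceq> x \<Longrightarrow> z \<preceq> y \<Longrightarrow> x \<in> carrier A \<Longrightarrow> y \<in> carrier A \<Longrightarrow> z \<in> carrier A \<Longrightarrow> z \<preceq> x \<curlywedge> y"
  by (metis l0_le_def wedge_assoc)

lemma res_elim:
  assumes "x \<in> carrier A" "y \<in> carrier A"
  shows "(x \<leadsto> y) \<otimes> x \<preceq> y" "x \<otimes> (x \<leadsto> y) \<preceq> y"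
proof -
  show "(x \<leadsto> y) \<otimes> x \<preceq> y"
    using assms by (simp add: residuation)
  then show "x \<otimes> (x \<leadsto> y) \<preceq> y"
    using assms by (simp add: m_comm)
qed

lemma mult_mono_left:
  assumes "x \<preceq> y" "x \<in> carrier A" "y \<in> carrier A" "z \<in> carrier A"
  shows "x \<otimes> z \<preceq> y \<otimes> z"
  by (meson assms residuation le_trans le_refl m_closed res_closed)

lemma mult_mono:
  assumes "x \<preceq> x'" "y \<preceq> y'" "x \<in> carrier A" "x' \<in> carrier A" "y \<in> carrier A" "y' \<in> carrier A"
  shows "x \<otimes> y \<preceq> x' \<otimes> y'"
  by (metis assms mult_mono_left m_comm le_trans m_closed)

lemma res_mono:
  assumes "y \<preceq> y'" "x' \<preceq> x" "x \<in> carrier A" "x' \<in> carrier A" "y \<in> carrier A" "y' \<in> carrier A"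
  shows "x \<leadsto> y \<preceq> x' \<leadsto> y'"
proof -
  have "(x \<leadsto> y) \<otimes> x' \<preceq> (x \<leadsto> y) \<otimes> x"
    using assms by (intro mult_mono) auto
  moreover have "(x \<leadsto> y) \<otimes> x \<preceq> y"
    using assms by (intro res_elim)
  ultimately have "(x \<leadsto> y) \<otimes> x' \<preceq> y'"
    using assms by (meson le_trans m_closed res_closed)
  then show ?thesis
    using assms by (simp add: residuation)
qed

text \<open>Residuation describes the elements below a residual, so identities between residuals
  follow by comparing lower bounds.\<close>

lemma eq_if_lower_eq:
  assumes "\<And>z. z \<in> carrier A \<Longrightarrow> z \<preceq> x \<longleftrightarrow> z \<preceq> y" "x \<in> carrier A" "y \<in> carrier A"
  shows "x = y"
  using assms le_antisym le_refl by blast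

lemma res_curry:
  assumes "x \<in> carrier A" "y \<in> carrier A" "z \<in> carrier A"
  shows "(x \<otimes> y) \<leadsto> z = x \<leadsto> y \<leadsto> z"
  using assms by (intro eq_if_lower_eq) (simp_all add: residuation[symmetric] m_assoc)

lemma res_exchange:
  assumes "x \<in> carrier A" "y \<in> carrier A" "z \<in> carrier A"
  shows "x \<leadsto> y \<leadsto> z = y \<leadsto> x \<leadsto> z"
  using assms by (metis res_curry m_comm)

lemma one_le_res:
  "x \<in> carrier A \<Longrightarrow> y \<in> carrier A \<Longrightarrow> \<one> \<preceq> x \<leadsto> y \<longleftrightarrow> x \<preceq> y"
  by (simp add: residuation[symmetric])

lemma eval_closed [simp]: "range e \<subseteq> carrier A \<Longrightarrow> eval A e \<phi> \<in> carrier A"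
  by (induction \<phi>) auto

end

section \<open>Divisibility, prelinearity and validity of the axioms in MV-algebras\<close>

context mv_algebra
begin

lemma mult_le: "x \<in> carrier A \<Longrightarrow> y \<in> carrier A \<Longrightarrow> x \<otimes> y \<preceq> x"
  by (metis mult_mono integral le_refl one_closed r_one)

lemma mult_le2: "x \<in> carrier A \<Longrightarrow> y \<in> carrier A \<Longrightarrow> x \<otimes> y \<preceq> y"
  by (metis mult_le m_comm)

text \<open>De Morgan duality: the residual into the least element \<open>z\<close> is an
  order-reversing involution. It turns the product into the join of the negations of
  \<open>x\<close> and \<open>y\<close>, which lies below the negation of the meet. The reverse
  inequality is direct.\<close>

lemma wedge_eq_mult_res:
  assumes x: "x \<in> carrier A" and y: "y \<in> carrier A"
  shows "x \<curlywedge> y = x \<otimes> (x \<leadsto> y)"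
proof -
  obtain z where z: "z \<in> carrier A" "\<And>x. x \<in> carrier A \<Longrightarrow> z \<preceq> x"
    using bounded by blast
  \<comment> \<open>By \<open>vee_eq\<close> the left-hand side is \<open>u \<curlyvee> z\<close>,
    and \<open>z\<close> is least.\<close>
  have dneg: "(u \<leadsto> z) \<leadsto> z = u" if "u \<in> carrier A" for u
    using that z by (metis vee_eq le_iff_vee vee_commute)
  \<comment> \<open>Write \<open>v\<close> as its double negation and exchange the two
    antecedents.\<close>
  have contra: "u \<leadsto> v = (v \<leadsto> z) \<leadsto> (u \<leadsto> z)" if "u \<in> carrier A" "v \<in> carrier A" for u v
    using that z by (metis res_exchange dneg res_closed)
  have anti: "u \<preceq> v" if "v \<leadsto> z \<preceq> u \<leadsto> z" "u \<in> carrier A" "v \<in> carrier A" for u v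
    using that z by (metis contra one_le_res res_closed)
  define s where "s = (x \<leadsto> z) \<curlyvee> (y \<leadsto> z)"
  have s: "s \<in> carrier A"
    using x y z by (simp add: s_def)
  \<comment> \<open>After currying and exchange, contraposing \<open>x \<leadsto> y\<close> produces
    the shape \<open>(p \<leadsto> q) \<leadsto> q\<close> of a join.\<close>
  have "(x \<otimes> (x \<leadsto> y)) \<leadsto> z = (x \<leadsto> y) \<leadsto> (x \<leadsto> z)"
    using x y z by (simp add: res_curry res_exchange[of x])
  also have "\<dots> = s"
    using x y z by (simp add: s_def contra[of x y] vee_eq[symmetric] vee_commute)
  finally have prod: "(x \<otimes> (x \<leadsto> y)) \<leadsto> z = s" .
  show ?thesis
  proof (rule le_antisym)
    have "x \<leadsto> z \<preceq> (x \<curlywedge> y) \<leadsto> z" "y \<leadsto> z \<preceq> (x \<curlywedge> y) \<leadsto> z"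
      using x y z(1) by (simp_all add: res_mono wedge_le)
    then have "s \<preceq> (x \<curlywedge> y) \<leadsto> z"
      using x y z(1) by (simp add: s_def vee_least)
    then show "x \<curlywedge> y \<preceq> x \<otimes> (x \<leadsto> y)"
      using anti[of "x \<otimes> (x \<leadsto> y)" "x \<curlywedge> y"] x y by (simp add: prod)
    show "x \<otimes> (x \<leadsto> y) \<preceq> x \<curlywedge> y"
      using x y by (intro wedge_greatest mult_le res_elim) auto
  qed (use x y in auto)
qed

text \<open>The key identity is \<open>(x \<leadsto> y) \<leadsto> (y \<leadsto> x) = y \<leadsto>
  x\<close>; with it, \<open>vee_eq\<close> turns the join into the residual of
  \<open>y \<leadsto> x\<close> into itself.\<close>

lemma vee_res_res:
  assumes x: "x \<in> carrier A" and y: "y \<in> carrier A"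
  shows "(x \<leadsto> y) \<curlyvee> (y \<leadsto> x) = \<one>"
proof -
  define m where "m = x \<curlywedge> y"
  have m: "m \<in> carrier A" "m \<preceq> x"
    using x y wedge_le by (auto simp: m_def)
  have res_wedge: "u \<leadsto> (v \<curlywedge> u) = u \<leadsto> v" "u \<leadsto> (u \<curlywedge> v) = u \<leadsto> v"
    if "u \<in> carrier A" "v \<in> carrier A" for u v
  proof -
    have "u \<leadsto> v \<preceq> u \<leadsto> (u \<curlywedge> v)"
      using that by (simp add: residuation[symmetric] wedge_greatest res_elim m_comm mult_le)
    moreover have "u \<leadsto> (u \<curlywedge> v) \<preceq> u \<leadsto> v"
      using that by (intro res_mono) (auto intro: wedge_le)
    ultimately show "u \<leadsto> (u \<curlywedge> v) = u \<leadsto> v"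
      using that by (intro le_antisym) auto
    then show "u \<leadsto> (v \<curlywedge> u) = u \<leadsto> v"
      using that by (simp add: wedge_commute)
  qed
  \<comment> \<open>With the meet \<open>m\<close> as common target, the exchange leaves
    \<open>(x \<leadsto> m) \<leadsto> m\<close>, which is \<open>x \<curlyvee> m\<close> and hence
    \<open>x\<close>.\<close>
  have "(x \<leadsto> m) \<leadsto> (y \<leadsto> m) = y \<leadsto> ((x \<leadsto> m) \<leadsto> m)"
    using x y m by (intro res_exchange) auto
  also have "\<dots> = y \<leadsto> x"
    using x y m by (metis vee_eq le_iff_vee vee_commute)
  finally have "(x \<leadsto> y) \<leadsto> (y \<leadsto> x) = y \<leadsto> x"
    using x y by (simp add: m_def res_wedge)
  then show ?thesis
    using x y by (simp add: vee_eq integral le_antisym one_le_res)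
qed

text \<open>Both \<open>x \<leadsto> y\<close> and \<open>y \<leadsto> x\<close> lie below
  \<open>u \<leadsto> z\<close>, where \<open>u\<close> is the product of the two hypotheses. Their
  join is \<one>, so \<open>u\<close> lies below \<open>z\<close>.\<close>

lemma prelinearity_le:
  assumes x: "x \<in> carrier A" and y: "y \<in> carrier A" and z: "z \<in> carrier A"
  shows "(x \<leadsto> y) \<leadsto> z \<preceq> ((y \<leadsto> x) \<leadsto> z) \<leadsto> z"
proof -
  define u where "u = ((x \<leadsto> y) \<leadsto> z) \<otimes> ((y \<leadsto> x) \<leadsto> z)"
  have u: "u \<in> carrier A"
    using x y z by (simp add: u_def)
  have "u \<preceq> (x \<leadsto> y) \<leadsto> z"
    using x y z by (simp add: u_def mult_le)
  then have "x \<leadsto> y \<preceq> u \<leadsto> z"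
    using x y z u by (metis residuation m_comm res_closed)
  moreover have "u \<preceq> (y \<leadsto> x) \<leadsto> z"
    using x y z by (simp add: u_def mult_le2)
  then have "y \<leadsto> x \<preceq> u \<leadsto> z"
    using x y z u by (metis residuation m_comm res_closed)
  ultimately have "(x \<leadsto> y) \<curlyvee> (y \<leadsto> x) \<preceq> u \<leadsto> z"
    using x y z u by (intro vee_least) auto
  then have "u \<preceq> z"
    using x y z u by (simp add: vee_res_res one_le_res)
  then show ?thesis
    using x y z by (simp add: u_def residuation)
qed

lemma suffixing_le:
  assumes "x \<in> carrier A" "y \<in> carrier A" "z \<in> carrier A"
  shows "x \<leadsto> y \<preceq> (y \<leadsto> z) \<leadsto> x \<leadsto> z"
proof -
  have "(x \<leadsto> y) \<otimes> x \<otimes> (y \<leadsto> z) \<preceq> y \<otimes> (y \<leadsto> z)"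
    using assms by (intro mult_mono_left res_elim) auto
  then have "(x \<leadsto> y) \<otimes> x \<otimes> (y \<leadsto> z) \<preceq> z"
    using assms by (meson le_trans m_closed res_closed res_elim)
  then show ?thesis
    using assms by (simp add: residuation res_exchange[of "y \<leadsto> z"])
qed

text \<open>Divisibility and the Wajsberg axiom become commutativity of meet and join; importation
  and exportation become the two directions of currying.\<close>

lemma eval_luk_axiom:
  assumes "\<alpha> \<in> luk_axioms" "range e \<subseteq> carrier A"
  shows "\<one> \<preceq> eval A e \<alpha>"
  using assms
proof (induction rule: luk_axioms.induct)
  case (divisibility \<phi> \<psi>)
  then show ?case
    by (simp add: one_le_res wedge_eq_mult_res[symmetric] wedge_commute)
next
  case (wajsberg \<phi> \<psi>)
  then show ?case
    by (simp add: one_le_res vee_eq[symmetric] vee_commute)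
next
  case (importation \<phi> \<psi> \<chi>)
  then show ?case
    by (simp add: one_le_res res_curry)
next
  case (exportation \<phi> \<psi> \<chi>)
  then show ?case
    by (simp add: one_le_res res_curry)
qed (auto simp: one_le_res wedge_eq_mult_res vee_eq suffixing_le mult_le m_comm prelinearity_le)

lemma eval_luk_provable:
  assumes "luk_provable \<phi>" "range e \<subseteq> carrier A"
  shows "\<one> \<preceq> eval A e \<phi>"
  using assms
proof (induction rule: luk_provable.induct)
  case (mp \<phi> \<psi>)
  then show ?case
    by (auto simp: one_le_res intro: le_trans[of \<one> "eval A e \<phi>"])
qed (rule eval_luk_axiom)

end

lemma luk_le_imp_MV_valid_le: "\<phi> \<lesssim> \<psi> \<Longrightarrow> MV_valid_le TYPE('a) \<phi> \<psi>"
  unfolding MV_valid_le_def luk_le_def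
proof (intro allI impI)
  fix A :: "'a l0_algebra" and e :: "nat \<Rightarrow> 'a"
  assume "luk_provable (\<phi> \<^bold>\<rightarrow> \<psi>)" "mv_algebra A" and e: "range e \<subseteq> carrier A"
  then interpret mv_algebra A
    by simp
  have "\<one>\<^bsub>A\<^esub> \<preceq>\<^bsub>A\<^esub> eval A e (\<phi> \<^bold>\<rightarrow> \<psi>)"
    by (rule eval_luk_provable) fact+
  then show "eval A e \<phi> \<preceq>\<^bsub>A\<^esub> eval A e \<psi>"
    using e by (simp add: one_le_res)
qed


section \<open>Completeness\<close>

text \<open>Countability allows classes of formulas to be coded in an arbitrary infinite
  type.\<close>

instance fm :: countable
  by countable_datatype

text \<open>This substitute for falsum multiplies at every connective, so that its value on a
  formula lies below its value on each subformula, and hence below the subformula itself.\<close>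

primrec var_product :: "fm \<Rightarrow> fm" where
  "var_product (Var n) = Var n"
| "var_product \<^bold>1 = \<^bold>1"
| "var_product (\<phi> \<^bold>\<and> \<psi>) = var_product \<phi> \<^bold>\<otimes> var_product \<psi>"
| "var_product (\<phi> \<^bold>\<or> \<psi>) = var_product \<phi> \<^bold>\<otimes> var_product \<psi>"
| "var_product (\<phi> \<^bold>\<otimes> \<psi>) = var_product \<phi> \<^bold>\<otimes> var_product \<psi>"
| "var_product (\<phi> \<^bold>\<rightarrow> \<psi>) = var_product \<phi> \<^bold>\<otimes> var_product \<psi>"

lemma var_product_le: "var_product \<phi> \<lesssim> \<phi>"
proof (induction \<phi>)
  case (Meet \<phi> \<psi>)
  then have "var_product (\<phi> \<^bold>\<and> \<psi>) \<lesssim> \<phi> \<^bold>\<otimes> \<psi>"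
    by (simp add: luk_tensor_mono)
  also have "\<phi> \<^bold>\<otimes> \<psi> \<lesssim> \<phi> \<^bold>\<and> \<psi>"
    by (simp add: luk_le_meet luk_tensor_le1 luk_tensor_le2)
  finally show ?case .
next
  case (Join \<phi> \<psi>)
  then show ?case
    by (simp, meson luk_tensor_le1 luk_join_ge1 luk_le_trans)
next
  case (Imp \<phi> \<psi>)
  then show ?case
    by (simp, meson luk_tensor_le2 luk_le_imp luk_le_trans)
qed (auto simp: luk_tensor_mono)

text \<open>
  The map \<open>g\<close> is meant to code classes of provably equivalent formulas as elements of \<open>'a\<close>.
\<close>

definition interval_algebra :: "(fm \<Rightarrow> 'a) \<Rightarrow> fm \<Rightarrow> 'a l0_algebra" where
  "interval_algebra g a = (let h = inv_into UNIV g in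
     \<lparr>carrier = g ` {\<phi>. a \<lesssim> \<phi>},
      monoid.mult = \<lambda>x y. g ((h x \<^bold>\<otimes> h y) \<^bold>\<or> a),
      one = g \<^bold>1,
      wedge = \<lambda>x y. g (h x \<^bold>\<and> h y),
      vee = \<lambda>x y. g (h x \<^bold>\<or> h y),
      res = \<lambda>x y. g (h x \<^bold>\<rightarrow> h y)\<rparr>)"

section \<open>Intervals of the algebra of formula classes\<close>

context
  fixes g :: "fm \<Rightarrow> 'a" and a :: fm
  assumes g_eq_iff: "\<And>\<phi> \<psi>. g \<phi> = g \<psi> \<longleftrightarrow> \<phi> \<simeq> \<psi>"
begin

lemma interval_rep: "inv_into UNIV g (g \<phi>) \<simeq> \<phi>"
  by (simp add: g_eq_iff[symmetric] f_inv_into_f)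

text \<open>The operations act on chosen representatives; since the connectives respect equivalence,
  any representatives give the same result.\<close>

lemma interval_simps:
  "carrier (interval_algebra g a) = g ` {\<phi>. a \<lesssim> \<phi>}"
  "\<one>\<^bsub>interval_algebra g a\<^esub> = g \<^bold>1"
  "g \<phi> \<otimes>\<^bsub>interval_algebra g a\<^esub> g \<psi> = g ((\<phi> \<^bold>\<otimes> \<psi>) \<^bold>\<or> a)"
  "g \<phi> \<curlywedge>\<^bsub>interval_algebra g a\<^esub> g \<psi> = g (\<phi> \<^bold>\<and> \<psi>)"
  "g \<phi> \<curlyvee>\<^bsub>interval_algebra g a\<^esub> g \<psi> = g (\<phi> \<^bold>\<or> \<psi>)"
  "g \<phi> \<leadsto>\<^bsub>interval_algebra g a\<^esub> g \<psi> = g (\<phi> \<^bold>\<rightarrow> \<psi>)"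
  by (auto simp: interval_algebra_def Let_def g_eq_iff
      intro!: luk_tensor_cong luk_imp_cong luk_meet_cong luk_join_cong interval_rep)

lemma interval_le_iff: "g \<phi> \<preceq>\<^bsub>interval_algebra g a\<^esub> g \<psi> \<longleftrightarrow> \<phi> \<lesssim> \<psi>"
proof -
  have "\<phi> \<^bold>\<and> \<psi> \<simeq> \<phi> \<longleftrightarrow> \<phi> \<lesssim> \<psi>"
    by (simp add: luk_equiv_def luk_meet_le1 luk_le_meet_iff)
  then show ?thesis
    by (simp add: l0_le_def interval_simps g_eq_iff)
qed

text \<open>On either side the upper bounds are those of \<open>a\<close> and of the threefold
  product; the stray products with \<open>a\<close> already lie below \<open>a\<close>.\<close>

lemma interval_mult_assoc:
  "(\<phi> \<^bold>\<otimes> \<psi> \<^bold>\<or> a) \<^bold>\<otimes> \<chi> \<^bold>\<or> a \<simeq> \<phi> \<^bold>\<otimes> (\<psi> \<^bold>\<otimes> \<chi> \<^bold>\<or> a) \<^bold>\<or> a"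
proof -
  have "a \<^bold>\<otimes> \<chi> \<lesssim> \<alpha>" "\<phi> \<^bold>\<otimes> a \<lesssim> \<alpha>" if "a \<lesssim> \<alpha>" for \<alpha>
    using that luk_tensor_le1 luk_tensor_le2 luk_le_trans by blast+
  moreover have "\<phi> \<^bold>\<otimes> \<psi> \<^bold>\<otimes> \<chi> \<lesssim> \<alpha> \<longleftrightarrow> \<phi> \<^bold>\<otimes> (\<psi> \<^bold>\<otimes> \<chi>) \<lesssim> \<alpha>" for \<alpha>
    using luk_tensor_assoc_equiv luk_equiv_iff_upper by blast
  ultimately show ?thesis
    by (auto simp: luk_equiv_iff_upper luk_join_le_iff luk_join_tensor_le_iff luk_tensor_join_le_iff)
qed

text \<open>The truncated product is still residuated: joining it with \<open>a\<close> does not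
  change which elements of the interval lie above it. The least element is
  \<open>g a\<close>.\<close>

lemma interval_mv_algebra: "mv_algebra (interval_algebra g a)"
proof -
  have ge_mult: "a \<lesssim> \<phi> \<^bold>\<otimes> \<psi> \<^bold>\<or> a" for \<phi> \<psi>
    by (rule luk_join_ge2)
  have join_absorb: "\<phi> \<^bold>\<or> a \<simeq> \<phi>" if "a \<lesssim> \<phi>" for \<phi>
    using that by (simp add: luk_equiv_def luk_join_le luk_join_ge1)
  have unit_left: "\<^bold>1 \<^bold>\<otimes> \<phi> \<^bold>\<or> a \<simeq> \<phi>" and unit_right: "\<phi> \<^bold>\<otimes> \<^bold>1 \<^bold>\<or> a \<simeq> \<phi>" if "a \<lesssim> \<phi>" for \<phi>
    using that luk_tensor_one join_absorb luk_join_cong luk_equiv_trans luk_equiv_refl by meson+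
  have comm: "\<phi> \<^bold>\<otimes> \<psi> \<^bold>\<or> a \<simeq> \<psi> \<^bold>\<otimes> \<phi> \<^bold>\<or> a" for \<phi> \<psi>
    by (intro luk_join_cong luk_tensor_commute luk_equiv_refl)
  have ge_join: "a \<lesssim> \<phi> \<^bold>\<or> \<psi>" if "a \<lesssim> \<phi>" for \<phi> \<psi>
    using that luk_join_ge1 luk_le_trans by blast
  \<comment> \<open>This is closure under implication in residuated form, the form into which
    \<open>luk_residuation[symmetric]\<close> rewrites that goal.\<close>
  have ge_imp: "a \<^bold>\<otimes> \<phi> \<lesssim> \<psi>" if "a \<lesssim> \<psi>" for \<phi> \<psi>
    using that luk_tensor_le1 luk_le_trans by blast
  have meet_comm: "\<phi> \<^bold>\<and> \<psi> \<simeq> \<psi> \<^bold>\<and> \<phi>" and meet_assoc: "(\<phi> \<^bold>\<and> \<psi>) \<^bold>\<and> \<chi> \<simeq> \<phi> \<^bold>\<and> (\<psi> \<^bold>\<and> \<chi>)" for \<phi> \<psi> \<chi>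
    by (auto simp: luk_equiv_iff_lower luk_le_meet_iff)
  have join_comm: "\<phi> \<^bold>\<or> \<psi> \<simeq> \<psi> \<^bold>\<or> \<phi>" and join_assoc: "(\<phi> \<^bold>\<or> \<psi>) \<^bold>\<or> \<chi> \<simeq> \<phi> \<^bold>\<or> (\<psi> \<^bold>\<or> \<chi>)" for \<phi> \<psi> \<chi>
    by (auto simp: luk_equiv_iff_upper luk_join_le_iff)
  have absorb: "\<phi> \<^bold>\<and> (\<phi> \<^bold>\<or> \<psi>) \<simeq> \<phi>" "\<phi> \<^bold>\<or> (\<phi> \<^bold>\<and> \<psi>) \<simeq> \<phi>" for \<phi> \<psi>
    by (auto simp: luk_equiv_def luk_le_meet_iff luk_join_le_iff luk_join_ge1 luk_meet_le1)
  have join_imp: "\<phi> \<^bold>\<or> \<psi> \<simeq> (\<phi> \<^bold>\<rightarrow> \<psi>) \<^bold>\<rightarrow> \<psi>" for \<phi> \<psi>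
    by (simp add: luk_equiv_def luk_le_axiom join1 join2)
  show ?thesis
    by unfold_locales
      (auto simp: interval_simps interval_le_iff g_eq_iff luk_join_le_iff luk_residuation[symmetric]
        luk_le_meet_iff luk_le_one ge_mult unit_left unit_right ge_join ge_imp interval_mult_assoc
        absorb intro: comm meet_comm meet_assoc join_comm join_assoc join_imp)
qed

text \<open>The hypothesis passes to subformulas, and it puts \<open>a\<close> below every product
  and variable occurring in \<phi>, so joining with \<open>a\<close> changes nothing there. For
  other variables the join keeps the valuation inside the carrier.\<close>

lemma eval_interval_algebra:
  assumes "a \<lesssim> var_product \<phi>"
  shows "eval (interval_algebra g a) (\<lambda>n. g (Var n \<^bold>\<or> a)) \<phi> = g \<phi>"
proof -
  have factors: "a \<lesssim> \<phi> \<^bold>\<otimes> \<psi> \<Longrightarrow> a \<lesssim> \<phi> \<and> a \<lesssim> \<psi>" for \<phi> \<psi>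
    using luk_tensor_le1 luk_tensor_le2 luk_le_trans by blast
  show ?thesis
    using assms
  proof (induction \<phi>)
    case (Var n)
    then show ?case
      by (simp add: g_eq_iff luk_equiv_def luk_join_le luk_join_ge1)
  next
    case (Tensor \<phi> \<psi>)
    then have le: "a \<lesssim> var_product \<phi>" "a \<lesssim> var_product \<psi>"
      by (auto dest: factors)
    have "a \<lesssim> \<phi> \<^bold>\<otimes> \<psi>"
      using Tensor.prems var_product_le luk_le_trans by blast
    then have "\<phi> \<^bold>\<otimes> \<psi> \<^bold>\<or> a \<simeq> \<phi> \<^bold>\<otimes> \<psi>"
      by (simp add: luk_equiv_def luk_join_le luk_join_ge1)
    with Tensor.IH le show ?case
      by (simp add: interval_simps g_eq_iff)
  qed (auto simp: interval_simps dest: factors)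
qed

end

lemma MV_valid_le_imp_luk_le:
  assumes inf: "infinite (UNIV :: 'a set)" and valid: "MV_valid_le TYPE('a) \<phi> \<psi>"
  shows "\<phi> \<lesssim> \<psi>"
proof -
  obtain f :: "nat \<Rightarrow> 'a" where f: "inj f"
    using inf infinite_countable_subset by blast
  \<comment> \<open>The choice depends only on the class of \<chi>, and \<open>to_nat\<close>
    followed by \<open>f\<close> codes the chosen representative injectively.\<close>
  define g where "g \<chi> = f (to_nat (SOME \<xi>. \<chi> \<simeq> \<xi>))" for \<chi>
  have g_eq_iff: "g \<chi> = g \<xi> \<longleftrightarrow> \<chi> \<simeq> \<xi>" for \<chi> \<xi>
  proof
    assume "g \<chi> = g \<xi>"
    then have "(SOME \<alpha>. \<chi> \<simeq> \<alpha>) = (SOME \<alpha>. \<xi> \<simeq> \<alpha>)"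
      using f by (simp add: g_def inj_eq)
    moreover have "\<beta> \<simeq> (SOME \<alpha>. \<beta> \<simeq> \<alpha>)" for \<beta>
      by (rule someI[of _ \<beta>]) simp
    ultimately show "\<chi> \<simeq> \<xi>"
      by (metis luk_equiv_sym luk_equiv_trans)
  next
    assume "\<chi> \<simeq> \<xi>"
    then have "(\<lambda>\<alpha>. \<chi> \<simeq> \<alpha>) = (\<lambda>\<alpha>. \<xi> \<simeq> \<alpha>)"
      by (metis luk_equiv_sym luk_equiv_trans)
    then show "g \<chi> = g \<xi>"
      by (simp add: g_def)
  qed
  \<comment> \<open>This lies below the variable products of both \<phi> and \<psi>, so one algebra
    evaluates both faithfully.\<close>
  define a where "a = var_product (\<phi> \<^bold>\<rightarrow> \<psi>)"
  let ?A = "interval_algebra g a" and ?e = "\<lambda>n. g (Var n \<^bold>\<or> a)"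
  have "range ?e \<subseteq> carrier ?A"
    by (auto simp: interval_simps[OF g_eq_iff] luk_join_ge2)
  then have "eval ?A ?e \<phi> \<preceq>\<^bsub>?A\<^esub> eval ?A ?e \<psi>"
    using valid interval_mv_algebra[OF g_eq_iff] by (simp add: MV_valid_le_def)
  moreover have "eval ?A ?e \<phi> = g \<phi>" "eval ?A ?e \<psi> = g \<psi>"
    by (simp_all add: eval_interval_algebra[OF g_eq_iff] a_def luk_tensor_le1 luk_tensor_le2)
  ultimately show ?thesis
    by (simp add: interval_le_iff[OF g_eq_iff])
qed

lemma MV_valid_le_iff:
  "infinite (UNIV :: 'a set) \<Longrightarrow> MV_valid_le TYPE('a) \<phi> \<psi> \<longleftrightarrow> \<phi> \<lesssim> \<psi>"
  using MV_valid_le_imp_luk_le luk_le_imp_MV_valid_le by blast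


section \<open>Derivations between multisets\<close>

lemma tensor_list_simps [simp]:
  "tensor_list [] = \<^bold>1" "tensor_list (\<phi> # \<phi>s) = \<phi> \<^bold>\<otimes> tensor_list \<phi>s"
  by (simp_all add: tensor_list_def)

lemma tensor_list_append: "tensor_list (\<phi>s @ \<psi>s) \<simeq> tensor_list \<phi>s \<^bold>\<otimes> tensor_list \<psi>s"
proof (induction \<phi>s)
  case Nil
  then show ?case
    by (simp add: luk_tensor_one luk_equiv_sym)
next
  case (Cons \<phi> \<phi>s)
  then have "tensor_list ((\<phi> # \<phi>s) @ \<psi>s) \<simeq> \<phi> \<^bold>\<otimes> (tensor_list \<phi>s \<^bold>\<otimes> tensor_list \<psi>s)"
    by (simp add: luk_tensor_cong)
  also have "\<dots> \<simeq> tensor_list (\<phi> # \<phi>s) \<^bold>\<otimes> tensor_list \<psi>s"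
    by (simp add: luk_equiv_sym luk_tensor_assoc_equiv)
  finally show ?case .
qed

text \<open>An occurrence of the head \<phi> is located in \<open>\<psi>s\<close> and moved to the
  front by associativity and commutativity.\<close>

lemma tensor_list_cong_mset: "mset \<phi>s = mset \<psi>s \<Longrightarrow> tensor_list \<phi>s \<simeq> tensor_list \<psi>s"
proof (induction \<phi>s arbitrary: \<psi>s)
  case (Cons \<phi> \<phi>s)
  then have "\<phi> \<in> set \<psi>s"
    by (metis list.set_intros(1) mset_eq_setD)
  then obtain us vs where \<psi>s: "\<psi>s = us @ \<phi> # vs"
    by (meson split_list)
  let ?u = "tensor_list us" and ?v = "tensor_list vs"
  have "tensor_list \<phi>s \<simeq> tensor_list (us @ vs)"
    using Cons \<psi>s by simp
  also have "\<dots> \<simeq> ?u \<^bold>\<otimes> ?v"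
    by (rule tensor_list_append)
  finally have "tensor_list (\<phi> # \<phi>s) \<simeq> \<phi> \<^bold>\<otimes> (?u \<^bold>\<otimes> ?v)"
    by (simp add: luk_tensor_cong)
  also have "\<dots> \<simeq> (\<phi> \<^bold>\<otimes> ?u) \<^bold>\<otimes> ?v"
    by (rule luk_equiv_sym, rule luk_tensor_assoc_equiv)
  also have "\<dots> \<simeq> (?u \<^bold>\<otimes> \<phi>) \<^bold>\<otimes> ?v"
    by (intro luk_tensor_cong luk_tensor_commute luk_equiv_refl)
  also have "\<dots> \<simeq> ?u \<^bold>\<otimes> (\<phi> \<^bold>\<otimes> ?v)"
    by (rule luk_tensor_assoc_equiv)
  also have "\<dots> \<simeq> tensor_list \<psi>s"
    using tensor_list_append[of us "\<phi> # vs"] by (simp add: \<psi>s luk_equiv_sym)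
  finally show ?case .
qed simp

text \<open>The syntactic counterpart of \<open>MV_entails\<close>. By \<open>mset_le_iff\<close>, a
  single choice of listings suffices to check it.\<close>

definition mset_le :: "fm multiset \<Rightarrow> fm multiset \<Rightarrow> bool" where
  "mset_le \<Gamma> \<Delta> \<longleftrightarrow> (\<forall>\<phi>s \<psi>s. mset \<phi>s = \<Gamma> \<and> mset \<psi>s = \<Delta> \<longrightarrow> tensor_list \<phi>s \<lesssim> tensor_list \<psi>s)"

lemma MV_entails_iff:
  "infinite (UNIV :: 'a set) \<Longrightarrow> MV_entails TYPE('a) \<Gamma> \<Delta> \<longleftrightarrow> mset_le \<Gamma> \<Delta>"
  by (simp add: MV_entails_def mset_le_def MV_valid_le_iff)

lemma mset_le_iff: "mset_le (mset \<phi>s) (mset \<psi>s) \<longleftrightarrow> tensor_list \<phi>s \<lesssim> tensor_list \<psi>s"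
  unfolding mset_le_def by (metis tensor_list_cong_mset luk_equiv_def luk_le_trans)

lemma mset_le_refl: "mset_le \<Gamma> \<Gamma>"
  by (metis ex_mset mset_le_iff luk_le_refl)

lemma mset_le_trans: "mset_le \<Gamma> \<Delta> \<Longrightarrow> mset_le \<Delta> \<Theta> \<Longrightarrow> mset_le \<Gamma> \<Theta>"
  by (metis ex_mset mset_le_iff luk_le_trans)

text \<open>Monotonicity of the product; \<Theta> is the part of a multiset that a derivation step
  leaves untouched.\<close>

lemma mset_le_add:
  assumes "mset_le \<Gamma> \<Gamma>'"
  shows "mset_le (\<Theta> + \<Gamma>) (\<Theta> + \<Gamma>')"
proof -
  obtain xs ys zs where eq: "\<Gamma> = mset xs" "\<Gamma>' = mset ys" "\<Theta> = mset zs"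
    by (metis ex_mset)
  have "tensor_list (zs @ xs) \<lesssim> tensor_list zs \<^bold>\<otimes> tensor_list xs"
    using tensor_list_append luk_equiv_def by blast
  also have "\<dots> \<lesssim> tensor_list zs \<^bold>\<otimes> tensor_list ys"
    using assms eq by (simp add: mset_le_iff luk_tensor_mono)
  also have "\<dots> \<lesssim> tensor_list (zs @ ys)"
    using tensor_list_append luk_equiv_def by blast
  finally show ?thesis
    by (metis eq mset_append mset_le_iff)
qed

lemma mset_le_empty: "mset_le \<Gamma> {#}"
  by (metis ex_mset mset_le_iff mset.simps(1) tensor_list_simps(1) luk_le_one)

text \<open>Integrality: the surplus formulas have a product below \<open>1\<close>, so they may be
  discarded.\<close>

lemma mset_le_supset: "\<Delta> \<subseteq># \<Gamma> \<Longrightarrow> mset_le \<Gamma> \<Delta>"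
  by (metis mset_le_add mset_le_empty subset_mset.add_diff_inverse add.right_neutral)

lemma mset_le_MV:
  assumes "(\<Psi>, \<Psi>') \<in> MV"
  shows "mset_le \<Psi> \<Psi>'"
proof -
  have "mset_le {#} {#\<alpha>#}" if "\<alpha> \<in> luk_axioms" for \<alpha>
  proof -
    have "\<^bold>1 \<lesssim> \<alpha> \<^bold>\<otimes> \<^bold>1"
      using that by (meson ax luk_le_iff_provable luk_le_tensor_one(1) luk_le_trans)
    then show ?thesis
      using mset_le_iff[of "[]" "[\<alpha>]"] by simp
  qed
  moreover have "mset_le {#\<phi>, \<phi> \<^bold>\<rightarrow> \<psi>#} {#\<psi>#}" for \<phi> \<psi>
  proof -
    have "(\<phi> \<^bold>\<otimes> (\<phi> \<^bold>\<rightarrow> \<psi>)) \<^bold>\<otimes> \<^bold>1 \<lesssim> \<psi> \<^bold>\<otimes> \<^bold>1"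
      by (intro luk_tensor_mono luk_imp_elim luk_le_refl)
    then show ?thesis
      using mset_le_iff[of "[\<phi>, \<phi> \<^bold>\<rightarrow> \<psi>]" "[\<psi>]"] luk_tensor_assoc(2) luk_le_trans by fastforce
  qed
  moreover have "mset_le {#\<phi> \<^bold>\<otimes> \<psi>#} {#\<phi>, \<psi>#}" for \<phi> \<psi>
    using mset_le_iff[of "[\<phi> \<^bold>\<otimes> \<psi>]" "[\<phi>, \<psi>]"] by (simp add: luk_tensor_assoc)
  ultimately show ?thesis
    using assms by (auto simp: MV_def MVs_def MP_def Tensor_Elim_def)
qed

section \<open>Derivations as reachability, and their soundness\<close>

definition deriv_step :: "consecution set \<Rightarrow> fm multiset \<Rightarrow> fm multiset \<Rightarrow> bool" where
  "deriv_step AS \<Gamma> \<Gamma>' \<longleftrightarrow> (\<exists>\<Psi> \<Psi>'. (\<Psi>, \<Psi>') \<in> AS \<and> \<Psi> \<subseteq># \<Gamma> \<and> \<Gamma>' = (\<Gamma> - \<Psi>) + \<Psi>')"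

text \<open>Reachability replaces indexed sequences, so that derivations can be composed and treated
  by induction.\<close>

lemma derives_iff_rtranclp:
  "derives AS \<Gamma> \<Delta> \<longleftrightarrow> (\<exists>\<Gamma>'. (deriv_step AS)\<^sup>*\<^sup>* \<Gamma> \<Gamma>' \<and> \<Delta> \<subseteq># \<Gamma>')"
proof
  assume "derives AS \<Gamma> \<Delta>"
  then obtain ds where ds: "ds \<noteq> []" "hd ds = \<Gamma>" "\<Delta> \<subseteq># last ds"
    and steps: "\<And>j. 0 < j \<Longrightarrow> j < length ds \<Longrightarrow> deriv_step AS (ds ! (j - 1)) (ds ! j)"
    unfolding derives_def is_derivation_def deriv_step_def by blast
  have "(deriv_step AS)\<^sup>*\<^sup>* \<Gamma> (ds ! j)" if "j < length ds" for j
    using that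
  proof (induction j)
    case 0
    then show ?case
      using ds by (simp add: hd_conv_nth)
  next
    case (Suc j)
    then show ?case
      using steps[of "Suc j"] by (simp add: rtranclp.rtrancl_into_rtrancl)
  qed
  then show "\<exists>\<Gamma>'. (deriv_step AS)\<^sup>*\<^sup>* \<Gamma> \<Gamma>' \<and> \<Delta> \<subseteq># \<Gamma>'"
    using ds by (metis last_conv_nth diff_less length_greater_0_conv zero_less_one)
next
  assume "\<exists>\<Gamma>'. (deriv_step AS)\<^sup>*\<^sup>* \<Gamma> \<Gamma>' \<and> \<Delta> \<subseteq># \<Gamma>'"
  then obtain \<Gamma>' where "(deriv_step AS)\<^sup>*\<^sup>* \<Gamma> \<Gamma>'" "\<Delta> \<subseteq># \<Gamma>'"
    by blast
  then show "derives AS \<Gamma> \<Delta>"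
  proof (induction rule: converse_rtranclp_induct)
    case base
    then have "is_derivation AS \<Gamma>' \<Delta> [\<Gamma>']"
      by (simp add: is_derivation_def)
    then show ?case
      unfolding derives_def by blast
  next
    case (step \<Theta> \<Theta>')
    then obtain ds where ds: "is_derivation AS \<Theta>' \<Delta> ds"
      unfolding derives_def by blast
    have "is_derivation AS \<Theta> \<Delta> (\<Theta> # ds)"
      unfolding is_derivation_def
    proof (intro conjI allI impI)
      fix j
      assume j: "0 < j \<and> j < length (\<Theta> # ds)"
      have "deriv_step AS ((\<Theta> # ds) ! (j - 1)) ((\<Theta> # ds) ! j)"
      \<comment> \<open>At index 1 the predecessor is the new head \<Theta>; every later index is an
        index of \<open>ds\<close> shifted by one.\<close>
      proof (cases "j = 1")
        case True
        then show ?thesis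
          using step.hyps ds by (auto simp: is_derivation_def hd_conv_nth)
      next
        case False
        then obtain i where i: "j = Suc i" "0 < i" "i < length ds"
          using j by (cases j) auto
        then have "deriv_step AS (ds ! (i - 1)) (ds ! i)"
          using ds by (simp add: is_derivation_def deriv_step_def)
        then show ?thesis
          using i by (simp add: nth_Cons')
      qed
      then show "\<exists>\<Psi> \<Psi>'. (\<Psi>, \<Psi>') \<in> AS \<and> \<Psi> \<subseteq># (\<Theta> # ds) ! (j - 1) \<and>
          (\<Theta> # ds) ! j = (\<Theta> # ds) ! (j - 1) - \<Psi> + \<Psi>'"
        by (simp add: deriv_step_def)
    qed (use ds in \<open>auto simp: is_derivation_def\<close>)
    then show ?case
      unfolding derives_def by blast
  qed
qed

lemma derives_MV_imp_mset_le: "derives MV \<Gamma> \<Delta> \<Longrightarrow> mset_le \<Gamma> \<Delta>"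
proof -
  have step: "mset_le \<Theta> \<Theta>'" if step: "deriv_step MV \<Theta> \<Theta>'" for \<Theta> \<Theta>'
  proof -
    obtain \<Psi> \<Psi>' where "(\<Psi>, \<Psi>') \<in> MV" "\<Psi> \<subseteq># \<Theta>" "\<Theta>' = (\<Theta> - \<Psi>) + \<Psi>'"
      using step by (auto simp: deriv_step_def)
    then show ?thesis
      \<comment> \<open>Since \<Psi> is contained in \<Theta>, adding it back to the truncated
        difference restores \<Theta>.\<close>
      using mset_le_add[OF mset_le_MV, of \<Psi> \<Psi>' "\<Theta> - \<Psi>"] by simp
  qed
  have "mset_le \<Theta> \<Theta>'" if "(deriv_step MV)\<^sup>*\<^sup>* \<Theta> \<Theta>'" for \<Theta> \<Theta>'
    using that by induction (auto intro: mset_le_refl mset_le_trans step)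
  then show "derives MV \<Gamma> \<Delta> \<Longrightarrow> mset_le \<Gamma> \<Delta>"
    using derives_iff_rtranclp mset_le_supset mset_le_trans by metis
qed

lemma deriv_step_mono:
  assumes "AS \<subseteq> AS'" "(deriv_step AS)\<^sup>*\<^sup>* \<Gamma> \<Delta>"
  shows "(deriv_step AS')\<^sup>*\<^sup>* \<Gamma> \<Delta>"
proof -
  have "deriv_step AS \<le> deriv_step AS'"
    using assms(1) unfolding deriv_step_def by blast
  then show ?thesis
    using assms(2) rtranclp_mono by blast
qed

section \<open>Constructing derivations from provable implications\<close>

lemma deriv_stepI: "(\<Psi>, \<Psi>') \<in> AS \<Longrightarrow> (deriv_step AS)\<^sup>*\<^sup>* (\<Theta> + \<Psi>) (\<Theta> + \<Psi>')"
  by (rule r_into_rtranclp) (force simp: deriv_step_def)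

lemma MVs_detach: "(deriv_step MVs)\<^sup>*\<^sup>* (\<Theta> + {#\<phi>, \<phi> \<^bold>\<rightarrow> \<psi>#}) (\<Theta> + {#\<psi>#})"
  by (rule deriv_stepI) (auto simp: MVs_def MP_def)

text \<open>Axioms have no premises, so theorems cost nothing. In the \<open>mp\<close> case both
  premises are generated first, and modus ponens then consumes exactly these copies.\<close>

lemma MVs_add_provable: "luk_provable \<phi> \<Longrightarrow> (deriv_step MVs)\<^sup>*\<^sup>* \<Theta> (\<Theta> + {#\<phi>#})"
proof (induction arbitrary: \<Theta> rule: luk_provable.induct)
  case (ax \<alpha>)
  then show ?case
    using deriv_stepI[of "{#}" "{#\<alpha>#}" MVs \<Theta>] by (simp add: MVs_def)
next
  case (mp \<phi> \<psi>)
  have "(deriv_step MVs)\<^sup>*\<^sup>* \<Theta> (\<Theta> + {#\<phi> \<^bold>\<rightarrow> \<psi>#} + {#\<phi>#})"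
    using mp.IH rtranclp_trans by metis
  also have "\<Theta> + {#\<phi> \<^bold>\<rightarrow> \<psi>#} + {#\<phi>#} = \<Theta> + {#\<phi>, \<phi> \<^bold>\<rightarrow> \<psi>#}"
    by simp
  finally show ?case
    using MVs_detach rtranclp_trans by metis
qed

text \<open>The formula \<chi> carries the implication still to be detached. Requiring only an
  inequality for it lets a product in the antecedent be curried on the way.\<close>

lemma MVs_detach_list:
  "\<chi> \<lesssim> tensor_list \<phi>s \<^bold>\<rightarrow> \<psi> \<Longrightarrow> (deriv_step MVs)\<^sup>*\<^sup>* (mset \<phi>s + {#\<chi>#}) {#\<psi>#}"
proof (induction \<phi>s arbitrary: \<chi>)
  case Nil
  \<comment> \<open>The empty list leaves the antecedent \<open>1\<close>, which residuation
    absorbs.\<close>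
  have "\<chi> \<lesssim> \<psi>"
    using Nil luk_residuation luk_le_tensor_one(1) luk_le_trans by fastforce
  then have "(deriv_step MVs)\<^sup>*\<^sup>* {#\<chi>#} ({#\<chi>#} + {#\<chi> \<^bold>\<rightarrow> \<psi>#})"
    unfolding luk_le_def by (rule MVs_add_provable)
  then show ?case
    using MVs_detach[of "{#}" \<chi> \<psi>] by (simp add: add_mset_commute)
next
  case (Cons \<phi> \<phi>s)
  let ?\<chi> = "tensor_list \<phi>s \<^bold>\<rightarrow> \<psi>"
  \<comment> \<open>Made into a theorem
    \<open>\<chi> \<rightarrow> \<phi> \<rightarrow> ?\<chi>\<close>, this allows two detachments
    that consume \<chi> and then \<phi>, leaving \<open>?\<chi>\<close> for the rest of the
    list.\<close>
  have "\<chi> \<lesssim> \<phi> \<^bold>\<rightarrow> ?\<chi>"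
    using Cons.prems luk_curry(1) luk_le_trans by fastforce
  then have "(deriv_step MVs)\<^sup>*\<^sup>* (mset \<phi>s + {#\<phi>, \<chi>#}) (mset \<phi>s + {#\<phi>, \<chi>#} + {#\<chi> \<^bold>\<rightarrow> \<phi> \<^bold>\<rightarrow> ?\<chi>#})"
    unfolding luk_le_def by (rule MVs_add_provable)
  moreover have "mset \<phi>s + {#\<phi>, \<chi>#} + {#\<chi> \<^bold>\<rightarrow> \<phi> \<^bold>\<rightarrow> ?\<chi>#} =
      mset \<phi>s + {#\<phi>#} + {#\<chi>, \<chi> \<^bold>\<rightarrow> \<phi> \<^bold>\<rightarrow> ?\<chi>#}"
    by simp
  ultimately have "(deriv_step MVs)\<^sup>*\<^sup>* (mset \<phi>s + {#\<phi>, \<chi>#}) (mset \<phi>s + {#\<phi>#} + {#\<phi> \<^bold>\<rightarrow> ?\<chi>#})"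
    using MVs_detach rtranclp_trans by metis
  then have "(deriv_step MVs)\<^sup>*\<^sup>* (mset \<phi>s + {#\<phi>, \<chi>#}) (mset \<phi>s + {#?\<chi>#})"
    using MVs_detach[of "mset \<phi>s" \<phi> ?\<chi>] by (simp add: add_mset_commute)
  then show ?case
    using Cons.IH[of ?\<chi>] by (simp add: add_mset_commute)
qed

lemma MVs_derives_tensor:
  assumes "tensor_list \<phi>s \<lesssim> \<psi>"
  shows "(deriv_step MVs)\<^sup>*\<^sup>* (mset \<phi>s) {#\<psi>#}"
proof -
  have "luk_provable (tensor_list \<phi>s \<^bold>\<rightarrow> \<psi>)"
    using assms by (simp add: luk_le_def)
  then have "(deriv_step MVs)\<^sup>*\<^sup>* (mset \<phi>s) (mset \<phi>s + {#tensor_list \<phi>s \<^bold>\<rightarrow> \<psi>#})"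
    by (rule MVs_add_provable)
  also have "(deriv_step MVs)\<^sup>*\<^sup>* \<dots> {#\<psi>#}"
    by (rule MVs_detach_list) simp
  finally show ?thesis .
qed

text \<open>The extra \<open>1\<close> is the end of the nested product; it does no harm, because a
  derivation only has to reach a multiset containing its goal.\<close>

lemma MV_split_tensor_list:
  "(deriv_step MV)\<^sup>*\<^sup>* (\<Theta> + {#tensor_list \<phi>s#}) (\<Theta> + mset \<phi>s + {#\<^bold>1#})"
proof (induction \<phi>s arbitrary: \<Theta>)
  case (Cons \<phi> \<phi>s)
  have "(deriv_step MV)\<^sup>*\<^sup>* (\<Theta> + {#tensor_list (\<phi> # \<phi>s)#}) (\<Theta> + {#\<phi>, tensor_list \<phi>s#})"
    by (rule deriv_stepI) (auto simp: MV_def Tensor_Elim_def)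
  also have "\<Theta> + {#\<phi>, tensor_list \<phi>s#} = \<Theta> + {#\<phi>#} + {#tensor_list \<phi>s#}"
    by simp
  also have "(deriv_step MV)\<^sup>*\<^sup>* \<dots> (\<Theta> + {#\<phi>#} + mset \<phi>s + {#\<^bold>1#})"
    by (rule Cons.IH)
  finally show ?case
    by simp
qed simp

lemma mset_le_imp_derives_MVs:
  assumes "mset_le \<Gamma> {#\<phi>#}"
  shows "derives MVs \<Gamma> {#\<phi>#}"
proof -
  obtain xs where xs: "\<Gamma> = mset xs"
    by (metis ex_mset)
  \<comment> \<open>A singleton list also ends its product with the factor \<open>1\<close>.\<close>
  have "tensor_list xs \<lesssim> \<phi> \<^bold>\<otimes> \<^bold>1"
    using assms mset_le_iff[of xs "[\<phi>]"] by (simp add: xs)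
  then have "tensor_list xs \<lesssim> \<phi>"
    using luk_tensor_le1 luk_le_trans by blast
  then show ?thesis
    using MVs_derives_tensor xs derives_iff_rtranclp by blast
qed

text \<open>Modus ponens first collapses \<Gamma> to the single product of \<Delta>; tensor
  elimination then takes that product apart.\<close>

lemma mset_le_imp_derives_MV:
  assumes "mset_le \<Gamma> \<Delta>"
  shows "derives MV \<Gamma> \<Delta>"
proof -
  obtain xs ys where eq: "\<Gamma> = mset xs" "\<Delta> = mset ys"
    by (metis ex_mset)
  have "(deriv_step MVs)\<^sup>*\<^sup>* \<Gamma> {#tensor_list ys#}"
    using assms by (simp add: eq mset_le_iff MVs_derives_tensor)
  then have "(deriv_step MV)\<^sup>*\<^sup>* \<Gamma> {#tensor_list ys#}"
    by (rule deriv_step_mono[rotated]) (simp add: MV_def)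
  also have "(deriv_step MV)\<^sup>*\<^sup>* \<dots> (\<Delta> + {#\<^bold>1#})"
    using MV_split_tensor_list[of "{#}" ys] by (simp add: eq)
  finally show ?thesis
    unfolding derives_iff_rtranclp by (metis mset_subset_eq_add_left)
qed

lemma derives_MVs_imp_MV: "derives MVs \<Gamma> \<Delta> \<Longrightarrow> derives MV \<Gamma> \<Delta>"
  unfolding derives_iff_rtranclp using deriv_step_mono[of MVs MV] by (auto simp: MV_def)

theorem theorem5p36:
  fixes \<Gamma> \<Delta> :: "fm multiset" and \<phi> :: fm
  assumes "infinite (UNIV :: 'a set)"
  shows "(derives MVs \<Gamma> {#\<phi>#} \<longleftrightarrow> MV_entails TYPE('a) \<Gamma> {#\<phi>#})
       \<and> (derives MV \<Gamma> \<Delta> \<longleftrightarrow> MV_entails TYPE('a) \<Gamma> \<Delta>)"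
  unfolding MV_entails_iff[OF assms]
  \<comment> \<open>Soundness of \<open>MVs\<close> is inherited from the larger system
    \<open>MV\<close>.\<close>
  using derives_MV_imp_mset_le derives_MVs_imp_MV mset_le_imp_derives_MVs mset_le_imp_derives_MV
  by blast

end
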